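(* Let $n = p_1^{a_1} p_2^{a_2} \cdots p_r^{a_r}$ where $p_1, \dots, p_r$ are distinct primes, $a_i \geq 1$, and $r \geq 2$, and let $n' = p_1 p_2 \cdots p_r$. Then $M(n) = M(n')$.
   Context: For a positive integer $n$, the unitary Cayley graph $X_n = \mathrm{Cay}(\mathbb{Z}_n, U_n)$ has vertex set $\mathbb{Z}_n$, and $x,y$ are adjacent iff $x - y \in U_n$, the group of units of $\mathbb{Z}_n$. An induced cycle of length $k \geq 3$ is a sequence of $k$ distinct vertices $v_0, \dots, v_{k-1}$ such that $v_i$ and $v_j$ are adjacent if and only if $i - j \equiv \pm 1 \pmod k$. $M(n)$ denotes the length of the longest induced cycle in $X_n$. *)

theory Defs
  imports "HOL-Number_Theory.Residues" "Graph_Theory.Pair_Digraph"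
begin

(* Cay(R, S) for the additive group of R.  The graph is represented as a set of
   ordered pairs; it is undirected whenever S is closed under negation, as it is
   for the units of a ring. *)
definition cayley_graph :: "('a, 'b) ring_scheme \<Rightarrow> 'a set \<Rightarrow> 'a pair_pre_digraph" where
  "cayley_graph R S =
     \<lparr> pverts = carrier R,
       parcs = {(x, y). x \<in> carrier R \<and> y \<in> carrier R \<and> x \<ominus>\<^bsub>R\<^esub> y \<in> S} \<rparr>"

(* For n = 1 the library's residue_ring is not a ring (its one is 1, outside the
   carrier {0}); this is harmless below, since an induced cycle needs at least
   three distinct vertices. *)
definition unitary_cayley_graph :: "nat \<Rightarrow> int pair_pre_digraph" where
  "unitary_cayley_graph n =
     cayley_graph (residue_ring (int n)) (Units (residue_ring (int n)))"

definition induced_cycle :: "'a pair_pre_digraph \<Rightarrow> 'a list \<Rightarrow> bool" where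
  "induced_cycle G vs \<longleftrightarrow>
     length vs \<ge> 3 \<and> distinct vs \<and> set vs \<subseteq> pverts G \<and>
     (\<forall>i < length vs. \<forall>j < length vs.
        (vs ! i, vs ! j) \<in> parcs G \<longleftrightarrow>
          [int i - int j = 1] (mod int (length vs)) \<or>
          [int i - int j = -1] (mod int (length vs)))"

(* The set is finite for n > 0, since lengths are bounded by n.  Max of the empty
   set is unspecified, so M n is meaningful only when X_n has an induced cycle;
   this is the case whenever n has at least two distinct prime factors. *)
definition M :: "nat \<Rightarrow> nat" where
  "M n = Max {length vs | vs. induced_cycle (unitary_cayley_graph n) vs}"

end

theory Submission
  imports Defs
begin

text \<open>Adjacency of \<open>x\<close> and \<open>y\<close> in \<open>X\<^sub>n\<close> means that \<open>x - y\<close> is coprime to \<open>n\<close>, which depends only on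
  the radical \<open>n'\<close> and on \<open>x - y\<close> modulo \<open>n'\<close>. Hence induced cycles of \<open>X\<^sub>n\<^sub>'\<close> are induced cycles of
  \<open>X\<^sub>n\<close>, and an induced cycle of \<open>X\<^sub>n\<close> reduces modulo \<open>n'\<close> to one of \<open>X\<^sub>n\<^sub>'\<close> unless two of its
  vertices collapse. Collapsing vertices have the same neighbours, which happens in a cycle only if
  its length is 4. Such short cycles are irrelevant, because \<open>X\<^sub>n\<^sub>'\<close> has an induced 6-cycle.\<close>

lemma unitary_cayley_graph_verts: "pverts (unitary_cayley_graph n) = {0..int n - 1}"
  by (simp add: unitary_cayley_graph_def cayley_graph_def residue_ring_def)

lemma unitary_cayley_graph_arcs:
  assumes "n > 1"
  shows "(x, y) \<in> parcs (unitary_cayley_graph n) \<longleftrightarrow>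
    x \<in> {0..int n - 1} \<and> y \<in> {0..int n - 1} \<and> coprime (x - y) (int n)"
proof -
  interpret residues "int n" "residue_ring (int n)"
    using assms by unfold_locales auto
  have minus: "x \<ominus>\<^bsub>residue_ring (int n)\<^esub> y = (x - y) mod int n"
    by (simp add: a_minus_def res_neg_eq res_add_eq mod_simps)
  have "(x - y) mod int n \<in> Units (residue_ring (int n)) \<longleftrightarrow> coprime (x - y) (int n)"
  proof -
    have "coprime ((x - y) mod int n) (int n) \<longleftrightarrow> coprime (x - y) (int n)"
      by (simp add: coprime_iff_gcd_eq_1 gcd.commute flip: gcd_red_int)
    moreover have "(x - y) mod int n \<ge> 0" "(x - y) mod int n < int n"
      using assms by auto
    \<comment> \<open>\<open>res_units_eq\<close> admits only positive residues as units. The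
      residue 0 does no harm, since it is not coprime to \<open>n > 1\<close>.\<close>
    moreover have "(x - y) mod int n \<noteq> 0" if "coprime ((x - y) mod int n) (int n)"
      using that assms by auto
    ultimately show ?thesis
      unfolding res_units_eq mem_Collect_eq by linarith
  qed
  then show ?thesis
    by (simp add: unitary_cayley_graph_def cayley_graph_def minus res_carrier_eq)
qed

lemma induced_cycle_unitary_iff:
  assumes "n > 1"
  shows "induced_cycle (unitary_cayley_graph n) vs \<longleftrightarrow>
    length vs \<ge> 3 \<and> distinct vs \<and> set vs \<subseteq> {0..int n - 1} \<and>
    (\<forall>i < length vs. \<forall>j < length vs.
      coprime (vs ! i - vs ! j) (int n) \<longleftrightarrow>
        [int i - int j = 1] (mod int (length vs)) \<or> [int i - int j = -1] (mod int (length vs)))"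
proof -
  have "vs ! i \<in> {0..int n - 1}" if "set vs \<subseteq> {0..int n - 1}" "i < length vs" for i
    using that nth_mem by blast
  then show ?thesis
    unfolding induced_cycle_def unitary_cayley_graph_verts unitary_cayley_graph_arcs[OF assms]
    by meson
qed

text \<open>Makes the set of cycle lengths finite, so that \<open>Max\<close> can be reasoned
  about.\<close>

lemma induced_cycle_length_le:
  assumes "induced_cycle (unitary_cayley_graph n) vs"
  shows "length vs \<le> n"
proof -
  have "length vs = card (set vs)"
    using assms by (simp add: induced_cycle_def distinct_card)
  also have "\<dots> \<le> card {0..int n - 1}"
    using assms by (intro card_mono) (auto simp: induced_cycle_def unitary_cayley_graph_verts)
  finally show ?thesis by simp
qed

text \<open>Think of \<open>i\<close> and \<open>j\<close> as positions on a \<open>k\<close>-cycle,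
  where both neighbours of \<open>i\<close> are also neighbours of \<open>j\<close>. Since
  \<open>i\<close> and \<open>j\<close> differ modulo \<open>k\<close>, \<open>i + 1\<close> can
  only be \<open>j - 1\<close> and \<open>i - 1\<close> can only be \<open>j + 1\<close>;
  subtracting the two congruences leaves 4.\<close>

lemma cycle_twins_length:
  fixes i j k :: int
  assumes next_adj: "[i + 1 - j = 1] (mod k) \<or> [i + 1 - j = -1] (mod k)"
    and prev_adj: "[i - 1 - j = 1] (mod k) \<or> [i - 1 - j = -1] (mod k)"
    and "\<not> [i = j] (mod k)"
  shows "k dvd 4"
proof -
  have "k dvd i - j + 2"
    using next_adj assms(3) by (auto simp: cong_iff_dvd_diff algebra_simps)
  moreover have "k dvd i - j - 2"
    using prev_adj assms(3) by (auto simp: cong_iff_dvd_diff algebra_simps)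
  ultimately have "k dvd (i - j + 2) - (i - j - 2)"
    by (rule dvd_diff)
  then show ?thesis by simp
qed

lemma coprime_cong_diff:
  fixes x y x' y' m :: int
  assumes "[x = x'] (mod m)" "[y = y'] (mod m)"
  shows "coprime (x - y) m \<longleftrightarrow> coprime (x' - y') m"
  using cong_diff[OF assms] by (metis coprime_cong_cong_left)

lemma induced_cycle_mod:
  assumes n: "n > 1" and m: "m > 1"
    and same: "\<And>x::int. coprime x (int n) \<longleftrightarrow> coprime x (int m)"
    and cycle: "induced_cycle (unitary_cayley_graph n) vs"
    and len: "length vs > 4"
  shows "induced_cycle (unitary_cayley_graph m) (map (\<lambda>x. x mod int m) vs)"
proof -
  define k where "k = length vs"
  have k: "k > 4" using len by (simp add: k_def)
  have adj: "coprime (vs ! i - vs ! j) (int m) \<longleftrightarrow>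
      [int i - int j = 1] (mod int k) \<or> [int i - int j = -1] (mod int k)"
    if "i < k" "j < k" for i j
    using cycle that unfolding induced_cycle_unitary_iff[OF n] same k_def by blast
  have inj: "i = j" if ij: "i < k" "j < k" and eq: "vs ! i mod int m = vs ! j mod int m" for i j
  proof (rule ccontr)
    assume "i \<noteq> j"
    then have ne: "\<not> [int i = int j] (mod int k)"
      using ij by (simp add: cong_def)
    \<comment> \<open>Positions \<open>l\<close> range over all integers, so that
      \<open>i + 1\<close> and \<open>i - 1\<close> can be inserted below without treating the
      wrap-around separately; \<open>l'\<close> is the list index in the same residue class.\<close>
    have nbr: "[l - int j = 1] (mod int k) \<or> [l - int j = -1] (mod int k)"
      if l: "[l - int i = 1] (mod int k) \<or> [l - int i = -1] (mod int k)" for l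
    proof -
      define l' where "l' = nat (l mod int k)"
      have l': "int l' = l mod int k" "l' < k"
        using k by (auto simp: l'_def nat_less_iff)
      have shift: "[int l' - c = d] (mod int k) \<longleftrightarrow> [l - c = d] (mod int k)" for c d
        by (simp add: l' cong_def mod_simps)
      have "coprime (vs ! l' - vs ! i) (int m)"
        using l l' ij adj shift by blast
      then have "coprime (vs ! l' - vs ! j) (int m)"
        using coprime_cong_diff[of "vs ! l'" "vs ! l'" "int m"] eq by (metis cong_def)
      then show ?thesis
        using l' ij adj shift by blast
    qed
    have "int k dvd 4"
      by (rule cycle_twins_length[OF nbr nbr ne]) (auto simp: cong_def)
    then show False
      using k zdvd_imp_le[of "int k" 4] by simp
  qed
  have "distinct (map (\<lambda>x. x mod int m) vs)"
    using inj by (auto simp: distinct_conv_nth k_def)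
  moreover have "set (map (\<lambda>x. x mod int m) vs) \<subseteq> {0..int m - 1}"
    using m by (auto simp: zle_diff1_eq)
  moreover have "coprime (vs ! i mod int m - vs ! j mod int m) (int m) \<longleftrightarrow>
      coprime (vs ! i - vs ! j) (int m)" for i j
    by (intro coprime_cong_diff) (auto simp: cong_def)
  ultimately show ?thesis
    using adj k unfolding induced_cycle_unitary_iff[OF m] by (simp add: k_def)
qed

lemma ex_induced_6_cycle:
  fixes q m :: nat
  assumes q: "q > 1" and m: "m > 1" "odd m" and "coprime q m"
  shows "\<exists>vs. induced_cycle (unitary_cayley_graph (q * m)) vs \<and> length vs = 6"
proof -
  have qm: "q * m > 1"
    using q m by (metis less_1_mult)
  \<comment> \<open>By the Chinese remainder theorem \<open>X\<close> contains the product of an edge (modulo \<open>q\<close>) and a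
    triangle (modulo \<open>m\<close>, where 1 and 2 are units), which is a hexagon.\<close>
  have "\<exists>x<q * m. [x = i mod 2] (mod q) \<and> [x = i mod 3] (mod m)" for i
    using binary_chinese_remainder_unique_nat[of q m "i mod 2" "i mod 3"] assms by auto
  then obtain v where v: "\<And>i. v i < q * m" "\<And>i. [v i = i mod 2] (mod q)"
      "\<And>i. [v i = i mod 3] (mod m)"
    by metis
  define vs where "vs = map (\<lambda>i. int (v i)) [0..<6]"
  have six: "i = 0 \<or> i = 1 \<or> i = 2 \<or> i = 3 \<or> i = 4 \<or> i = 5" if "i < 6" for i :: nat
    using that by linarith
  \<comment> \<open>Differences of residues modulo 3 lie between -2 and 2, so oddness of
    \<open>m\<close> makes every nonzero one a unit modulo \<open>m\<close>.\<close>
  have c2: "coprime 2 (int m)" "coprime (-2) (int m)"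
    using m by auto
  have q_part: "coprime (int (v i) - int (v j)) (int q) \<longleftrightarrow> i mod 2 \<noteq> j mod 2" for i j
  proof -
    have "coprime (int (v i) - int (v j)) (int q) \<longleftrightarrow> coprime (int (i mod 2) - int (j mod 2)) (int q)"
      using v(2) by (intro coprime_cong_diff) (auto simp only: cong_int_iff)
    moreover have "i mod 2 = 0 \<or> i mod 2 = 1" "j mod 2 = 0 \<or> j mod 2 = 1" by auto
    ultimately show ?thesis using q by auto
  qed
  have m_part: "coprime (int (v i) - int (v j)) (int m) \<longleftrightarrow> i mod 3 \<noteq> j mod 3" for i j
  proof -
    have "coprime (int (v i) - int (v j)) (int m) \<longleftrightarrow> coprime (int (i mod 3) - int (j mod 3)) (int m)"
      using v(3) by (intro coprime_cong_diff) (auto simp only: cong_int_iff)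
    moreover have "i mod 3 = 0 \<or> i mod 3 = 1 \<or> i mod 3 = 2" "j mod 3 = 0 \<or> j mod 3 = 1 \<or> j mod 3 = 2"
      by linarith+
    ultimately show ?thesis using m c2 by auto
  qed
  \<comment> \<open>If \<open>v i = v j\<close>, the difference 0 is coprime to neither
    \<open>q\<close> nor \<open>m\<close>, so \<open>i\<close> and \<open>j\<close> agree modulo 2
    and modulo 3, hence modulo 6.\<close>
  have "v i \<noteq> v j" if "i < 6" "j < 6" "i \<noteq> j" for i j
  proof
    assume "v i = v j"
    then have "i mod 2 = j mod 2" "i mod 3 = j mod 3"
      using q_part[of i j] m_part[of i j] q m by auto
    then show False
      using six[OF that(1)] six[OF that(2)] that(3) by auto
  qed
  then have "distinct vs"
    by (force simp: vs_def distinct_map inj_on_def)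
  moreover have "set vs \<subseteq> {0..int (q * m) - 1}"
    using v(1) by (auto simp: vs_def zle_diff1_eq simp flip: of_nat_mult)
  moreover have "coprime (vs ! i - vs ! j) (int (q * m)) \<longleftrightarrow>
      [int i - int j = 1] (mod 6) \<or> [int i - int j = -1] (mod 6)" if "i < 6" "j < 6" for i j
  proof -
    have "coprime (vs ! i - vs ! j) (int (q * m)) \<longleftrightarrow> i mod 2 \<noteq> j mod 2 \<and> i mod 3 \<noteq> j mod 3"
      using that q_part m_part by (simp add: vs_def)
    \<comment> \<open>The difference \<open>i - j\<close> is prime to both 2 and 3, and the only
      units modulo 6 are 1 and -1.\<close>
    also have "\<dots> \<longleftrightarrow> [int i - int j = 1] (mod 6) \<or> [int i - int j = -1] (mod 6)"
      using six[OF that(1)] six[OF that(2)] by (elim disjE) (simp_all add: cong_def)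
    finally show ?thesis .
  qed
  moreover have "length vs = 6" by (simp add: vs_def)
  ultimately show ?thesis
    unfolding induced_cycle_unitary_iff[OF qm] by (intro exI[of _ vs]) simp
qed

text \<open>The factorisation \<open>q * m\<close> with odd \<open>m\<close> supplies the hexagon.
  Its length makes both sets of lengths nonempty, so that both maxima are meaningful, and it exceeds
  every length that \<open>induced_cycle_mod\<close> leaves out.\<close>

lemma M_eq_of_same_units:
  fixes n q m :: nat
  assumes n: "n > 0" and dvd: "q * m dvd n"
    and same: "\<And>x::int. coprime x (int n) \<longleftrightarrow> coprime x (int (q * m))"
    and q: "q > 1" and m: "m > 1" "odd m" "coprime q m"
  shows "M n = M (q * m)"
proof -
  let ?L = "\<lambda>n. {length vs | vs. induced_cycle (unitary_cayley_graph n) vs}"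
  have fin: "finite (?L k)" for k
    by (rule finite_subset[of _ "{..k}"]) (auto dest: induced_cycle_length_le)
  have qm: "q * m > 1"
    using q m by (metis less_1_mult)
  have le: "q * m \<le> n"
    using dvd n by (rule dvd_imp_le)
  have six: "6 \<in> ?L (q * m)"
    using ex_induced_6_cycle[OF q m] by force
  \<comment> \<open>The same list serves in both graphs: vertices are the integers from 0 on, so the
    smaller vertex set lies inside the larger one, and \<open>same\<close> matches the
    adjacencies.\<close>
  have sub: "?L (q * m) \<subseteq> ?L n"
  proof -
    have "induced_cycle (unitary_cayley_graph n) vs"
      if "induced_cycle (unitary_cayley_graph (q * m)) vs" for vs
    proof -
      have "n > 1" using qm le by linarith
      moreover have "{0..int (q * m) - 1} \<subseteq> {0..int n - 1}" using le by (simp del: of_nat_mult)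
      ultimately show ?thesis
        using that unfolding induced_cycle_unitary_iff[OF qm] induced_cycle_unitary_iff[OF \<open>n > 1\<close>] same
        by blast
    qed
    then show ?thesis by blast
  qed
  have "Max (?L n) \<le> Max (?L (q * m))"
  proof (intro Max.boundedI fin)
    show "?L n \<noteq> {}" using six sub by blast
    fix l assume "l \<in> ?L n"
    then obtain vs where vs: "induced_cycle (unitary_cayley_graph n) vs" "l = length vs"
      by blast
    show "l \<le> Max (?L (q * m))"
    proof (cases "l > 4")
      case True
      have "induced_cycle (unitary_cayley_graph (q * m)) (map (\<lambda>x. x mod int (q * m)) vs)"
        using vs True qm le by (intro induced_cycle_mod[OF _ qm same]) auto
      then have "l \<in> ?L (q * m)"
        using vs(2) by (metis (mono_tags, lifting) length_map mem_Collect_eq)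
      then show ?thesis by (rule Max_ge[OF fin])
    next
      case False
      then show ?thesis using Max_ge[OF fin six] by linarith
    qed
  qed
  moreover have "Max (?L (q * m)) \<le> Max (?L n)"
    using six by (intro Max_mono[OF sub _ fin]) blast
  ultimately show ?thesis
    unfolding M_def by (rule antisym)
qed

theorem theorem2p10:
  fixes p a :: "nat \<Rightarrow> nat" and r n n' :: nat
  assumes "r \<ge> 2"
    and "\<And>i. i \<in> {1..r} \<Longrightarrow> prime (p i)"
    and "inj_on p {1..r}"
    and "\<And>i. i \<in> {1..r} \<Longrightarrow> a i \<ge> 1"
    and "n = (\<Prod>i=1..r. p i ^ a i)"
    and "n' = (\<Prod>i=1..r. p i)"
  shows "M n = M n'"
proof -
  \<comment> \<open>The prime 2, if it occurs, is split off as \<open>p s\<close>, so that the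
    product \<open>m\<close> of the other primes is odd.\<close>
  obtain s where s: "s \<in> {1..r}" and odd: "\<And>i. i \<in> {1..r} - {s} \<Longrightarrow> p i \<noteq> 2"
  proof (cases "\<exists>i\<in>{1..r}. p i = 2")
    case True
    then obtain s where "s \<in> {1..r}" "p s = 2" by blast
    with that[of s] assms(3) show ?thesis by (metis Diff_iff inj_onD singletonI)
  next
    case False
    with that[of 1] assms(1) show ?thesis by auto
  qed
  define m where "m = (\<Prod>i\<in>{1..r} - {s}. p i)"
  have n': "n' = p s * m"
    unfolding assms(6) m_def using s by (intro prod.remove) auto
  \<comment> \<open>A second index exists because \<open>r \<ge> 2\<close>; its prime divides
    \<open>m\<close>, which gives \<open>m > 1\<close>.\<close>
  have "(if s = 1 then 2 else 1) \<in> {1..r} - {s}"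
    using assms(1) by auto
  then obtain t where t: "t \<in> {1..r} - {s}" by blast
  have m_pos: "m > 0"
    unfolding m_def using assms(2) by (intro prod_pos) (auto simp: prime_gt_0_nat)
  have "p t dvd m"
    unfolding m_def using t by (intro dvd_prodI) auto
  then have "m > 1"
    using m_pos t assms(2) by (metis Diff_iff dvd_imp_le order_less_le_trans prime_gt_1_nat)
  moreover have "odd m"
  proof
    assume "even m"
    then obtain i where i: "i \<in> {1..r} - {s}" "even (p i)"
      unfolding m_def by (subst (asm) even_prod_iff) blast+
    then have "p i = 2"
      using assms(2)[of i] primes_dvd_imp_eq[OF two_is_prime_nat, of "p i"] by simp
    with odd[OF i(1)] show False by contradiction
  qed
  moreover have "coprime (p s) m"
    unfolding m_def
  proof (rule prod_coprime_right)
    fix i assume "i \<in> {1..r} - {s}"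
    then show "coprime (p s) (p i)"
      using s assms(2,3) by (intro primes_coprime) (auto dest: inj_onD)
  qed
  moreover have "n > 0"
    unfolding assms(5) using assms(2) by (intro prod_pos) (auto simp: prime_gt_0_nat)
  moreover have dvd: "n' dvd n"
    unfolding assms(5,6)
    by (intro prod_dvd_prod) (use assms(4) in \<open>auto simp: dvd_power Suc_le_eq\<close>)
  moreover have "coprime x (int n) \<longleftrightarrow> coprime x (int n')" for x
  proof
    show "coprime x (int n')" if "coprime x (int n)"
      using that dvd by (meson coprime_divisors dvd_refl int_dvd_int_iff)
    assume "coprime x (int n')"
    then have "coprime x (int (p i))" if "i \<in> {1..r}" for i
      using that dvd_prodI[of "{1..r}" i p] unfolding assms(6)
      by (meson coprime_divisors dvd_refl finite_atLeastAtMost int_dvd_int_iff)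
    then show "coprime x (int n)"
      unfolding assms(5) of_nat_prod of_nat_power
      by (intro prod_coprime_right) (simp add: coprime_power_right_iff)
  qed
  ultimately show ?thesis
    using M_eq_of_same_units[of n "p s" m] s assms(2) n' prime_gt_1_nat by simp
qed

end
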